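(* Let $n\geq 2$ be an integer, $A_0,A_1,\dots,A_n\in\widehat{\mathbb{F}_q^{*}}$ and $x\in\mathbb{F}_q$. Then $$ {}_{n+1}F_n\!\left(\begin{array}{cccc} A_0, & A_1, & \dots, & A_n\\ & A_0\bar{A_1}, & \dots, & A_0\bar{A_n}\end{array}\Big|\;x\right)_q^{\star} =\frac{g(\bar{A_0}A_{n-1}A_n)}{g(A_{n-1})g(A_n)g(\bar{A_0}A_{n-1})g(\bar{A_0}A_n)}\cdot\frac{1}{q-1}\sum_{\psi\in\widehat{\mathbb{F}_q^{*}}}g(A_{n-1}\psi)g(A_n\psi)g(\bar{\psi})g(\bar{A_0}\bar{\psi})\;{}_{n}F_{n-1}\!\left(\begin{array}{ccccc} A_0, & A_1, & \dots, & A_{n-2}, & \bar{\psi}\\ & A_0\bar{A_1}, & \dots, & A_0\bar{A_{n-2}}, & A_0\psi\end{array}\Big|\;-x\right)_q^{\star} $$ $$ +\frac{q(q-1)\,(A_nA_{n-1})(-1)\,\delta(\bar{A_0}A_{n-1}A_n)}{g(A_{n-1})g(A_n)g(\bar{A_0}A_{n-1})g(\bar{A_0}A_n)}\;{}_{n-1}F_{n-2}\!\left(\begin{array}{cccc} A_0, & A_1, & \dots, & A_{n-2}\\ & A_0\bar{A_1}, & \dots, & A_0\bar{A_{n-2}}\end{array}\Big|\;x\right)_q^{\star}. $$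
   Context: Let $q$ be a prime power and $\mathbb{F}_q$ the finite field with $q$ elements. $\widehat{\mathbb{F}_q^{*}}$ denotes the group of multiplicative characters of $\mathbb{F}_q^{*}$; every character $\chi$ (including the trivial character $\varepsilon$) is extended to $\mathbb{F}_q$ by $\chi(0):=0$. $\bar{\chi}$ denotes the inverse character, and juxtaposition denotes pointwise product of characters. Fix a non-trivial additive character $\theta$ of $\mathbb{F}_q$ and define the Gauss sum $g(\chi):=\sum_{x\in\mathbb{F}_q}\chi(x)\theta(x)$. For $A_0,\dots,A_m,B_1,\dots,B_m\in\widehat{\mathbb{F}_q^{*}}$ ($m\geq 0$) and $x\in\mathbb{F}_q$ define $$ {}_{m+1}F_m\!\left(\begin{array}{cccc} A_0, & A_1, & \dots, & A_m\\ & B_1, & \dots, & B_m\end{array}\Big|\;x\right)_q^{\star}:=\frac{1}{q-1}\sum_{\chi\in\widehat{\mathbb{F}_q^{*}}}\prod_{i=0}^{m}\frac{g(A_i\chi)}{g(A_i)}\prod_{j=1}^{m}\frac{g(\overline{B_j\chi})}{g(\overline{B_j})}\,g(\bar{\chi})\,\chi(-1)^{m+1}\chi(x). $$ For $\chi\in\widehat{\mathbb{F}_q^{*}}$, $\delta(\chi)=1$ if $\chi=\varepsilon$ and $\delta(\chi)=0$ otherwise. *)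

theory Defs
  imports Complex_Main "HOL-Library.Cardinality"
begin

text \<open>
  The finite field is a type of class \<open>{finite, field}\<close>, and its order is \<open>q = CARD('a)\<close>.
  A multiplicative character is a homomorphism from the nonzero elements of the field to the
  nonzero complex numbers, extended to the whole field by \<open>\<chi> 0 = 0\<close> (also for the trivial one).
\<close>

definition mult_chars :: "('a :: {finite, field} \<Rightarrow> complex) set" where
  "mult_chars = {\<chi>. \<chi> 0 = 0 \<and> (\<forall>x. x \<noteq> 0 \<longrightarrow> \<chi> x \<noteq> 0) \<and>
     (\<forall>x y. x \<noteq> 0 \<longrightarrow> y \<noteq> 0 \<longrightarrow> \<chi> (x * y) = \<chi> x * \<chi> y)}"

definition trivial_char :: "'a :: {finite, field} \<Rightarrow> complex" where
  "trivial_char x = (if x = 0 then 0 else 1)"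

definition char_mult :: "('a \<Rightarrow> complex) \<Rightarrow> ('a \<Rightarrow> complex) \<Rightarrow> 'a \<Rightarrow> complex"
    (infixl "\<odot>" 70) where
  "(\<chi> \<odot> \<psi>) x = \<chi> x * \<psi> x"

text \<open>Since \<open>inverse 0 = 0\<close>, the extension by zero is preserved.\<close>

definition char_inv :: "('a \<Rightarrow> complex) \<Rightarrow> 'a \<Rightarrow> complex" where
  "char_inv \<chi> x = inverse (\<chi> x)"

definition char_delta :: "('a :: {finite, field} \<Rightarrow> complex) \<Rightarrow> complex" where
  "char_delta \<chi> = (if \<chi> = trivial_char then 1 else 0)"

definition add_char :: "('a :: {finite, field} \<Rightarrow> complex) \<Rightarrow> bool" where
  "add_char \<theta> \<longleftrightarrow> (\<forall>x. \<theta> x \<noteq> 0) \<and> (\<forall>x y. \<theta> (x + y) = \<theta> x * \<theta> y)"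

definition nontrivial_add_char :: "('a :: {finite, field} \<Rightarrow> complex) \<Rightarrow> bool" where
  "nontrivial_add_char \<theta> \<longleftrightarrow> add_char \<theta> \<and> (\<exists>x. \<theta> x \<noteq> 1)"

definition gauss_sum ::
    "('a :: {finite, field} \<Rightarrow> complex) \<Rightarrow> ('a \<Rightarrow> complex) \<Rightarrow> complex" where
  "gauss_sum \<theta> \<chi> = (\<Sum>x\<in>UNIV. \<chi> x * \<theta> x)"

text \<open>
  \<open>hyp_star \<theta> m A B x\<close> is the function \<open>\<^bsub>m+1\<^esub>F\<^bsub>m\<^esub>\<close> with upper parameters \<open>A 0, \<dots>, A m\<close> and lower
  parameters \<open>B 1, \<dots>, B m\<close>; no other values of \<open>A\<close> and \<open>B\<close> (in particular not \<open>B 0\<close>) are used.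
\<close>

definition hyp_star ::
    "('a :: {finite, field} \<Rightarrow> complex) \<Rightarrow> nat \<Rightarrow> (nat \<Rightarrow> 'a \<Rightarrow> complex) \<Rightarrow>
     (nat \<Rightarrow> 'a \<Rightarrow> complex) \<Rightarrow> 'a \<Rightarrow> complex" where
  "hyp_star \<theta> m A B x =
     1 / (of_nat CARD('a) - 1) *
     (\<Sum>\<chi>\<in>mult_chars.
        (\<Prod>i=0..m. gauss_sum \<theta> (A i \<odot> \<chi>) / gauss_sum \<theta> (A i)) *
        (\<Prod>j=1..m. gauss_sum \<theta> (char_inv (B j \<odot> \<chi>)) / gauss_sum \<theta> (char_inv (B j))) *
        gauss_sum \<theta> (char_inv \<chi>) * \<chi> (- 1) ^ (m + 1) * \<chi> x)"

end

theory Submission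
  imports Defs "HOL-Algebra.Multiplicative_Group"
begin

text \<open>
  Comparing the coefficients of \<open>\<chi>(x)\<close> on both sides, the identity reduces to the finite field
  analogue of Barnes' first lemma (due to Helversen-Pasotto), in the form
  \<open>g(ac) g(ad) g(bc) g(bd) = g(abcd)/(q-1) \<Sum>\<psi>. g(a\<psi>) g(b\<psi>) g(c\<psi>\<inverse>) g(d\<psi>\<inverse>) + q(q-1) ab(-1) \<delta>(abcd)\<close>
  with \<open>a = A\<^bsub>n-1\<^esub>\<close>, \<open>b = A\<^bsub>n\<^esub>\<close>, \<open>c = \<chi>\<close>, \<open>d = (A\<^bsub>0\<^esub>\<chi>)\<inverse>\<close>.
  To prove it, write \<open>K \<chi> t = \<Sum>x. \<chi>(x) \<theta>((1+t)x)\<close>, so that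
  \<open>g(\<chi>) g(\<phi>) = \<Sum>t. \<phi>(t) K (\<chi>\<phi>) t\<close>. By orthogonality of characters the sum over \<open>\<psi>\<close>
  collapses to \<open>(q-1) \<Sum>t. bd(t) K (ad) t K (bc) t\<close>. For \<open>t \<noteq> -1\<close> one has
  \<open>g(abcd) K (ad) t K (bc) t = g(ad) g(bc) K (abcd) t\<close>, which sums to the product of four Gauss
  sums; the exceptional value \<open>t = -1\<close> contributes the term with \<open>\<delta>\<close>, through the reflection
  formula for \<open>g(\<chi>) g(\<chi>\<inverse>)\<close>.
\<close>

no_notation smult (infixl \<open>\<odot>\<index>\<close> 70)

section \<open>The group of multiplicative characters\<close>

text \<open>Extension by zero makes \<open>mult_char_mult\<close> unconditional: if a factor is 0,
  both sides vanish.\<close>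

lemma mult_char_0: "\<chi> \<in> mult_chars \<Longrightarrow> \<chi> 0 = 0"
  and mult_char_nonzero: "\<chi> \<in> mult_chars \<Longrightarrow> x \<noteq> 0 \<Longrightarrow> \<chi> x \<noteq> 0"
  and mult_char_mult: "\<chi> \<in> mult_chars \<Longrightarrow> \<chi> (x * y) = \<chi> x * \<chi> y"
  by (cases "x = 0"; cases "y = 0"; simp add: mult_chars_def)+

lemma mult_char_1:
  assumes "\<chi> \<in> mult_chars" shows "\<chi> 1 = 1"
  using mult_char_mult[OF assms, of 1 1] mult_char_nonzero[OF assms, of 1] by simp

lemma mult_char_power: "\<chi> \<in> mult_chars \<Longrightarrow> \<chi> (x ^ k) = \<chi> x ^ k"
  by (induction k) (simp_all add: mult_char_1 mult_char_mult)

lemma mult_char_inverse: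
  assumes "\<chi> \<in> mult_chars" shows "\<chi> (inverse x) = inverse (\<chi> x)"
proof (cases "x = 0")
  case False
  then have "\<chi> x * \<chi> (inverse x) = 1"
    using mult_char_mult[OF assms, of x "inverse x"] mult_char_1[OF assms] by simp
  then show ?thesis by (metis inverse_unique)
qed (simp add: mult_char_0[OF assms])

lemma mult_char_minus_1_square:
  assumes "\<chi> \<in> mult_chars" shows "\<chi> (- 1) * \<chi> (- 1) = 1"
  using mult_char_mult[OF assms, of "- 1" "- 1"] mult_char_1[OF assms] by simp

lemma char_mult_in_mult_chars: "\<chi> \<in> mult_chars \<Longrightarrow> \<psi> \<in> mult_chars \<Longrightarrow> \<chi> \<odot> \<psi> \<in> mult_chars"
  and char_inv_in_mult_chars: "\<chi> \<in> mult_chars \<Longrightarrow> char_inv \<chi> \<in> mult_chars"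
  and trivial_char_in_mult_chars: "trivial_char \<in> mult_chars"
  by (auto simp: mult_chars_def char_mult_def char_inv_def trivial_char_def)

lemmas mult_chars_closed =
  char_mult_in_mult_chars char_inv_in_mult_chars trivial_char_in_mult_chars

text \<open>These laws hold for arbitrary functions, because \<open>inverse\<close> on the complex
  numbers is multiplicative and involutive even at 0. Rearranging products therefore needs no
  membership facts; only cancelling \<open>\<chi>\<close> against \<open>char_inv \<chi>\<close>
  does.\<close>

lemma char_mult_commute: "\<chi> \<odot> \<psi> = \<psi> \<odot> \<chi>"
  and char_mult_assoc: "\<chi> \<odot> \<psi> \<odot> \<phi> = \<chi> \<odot> (\<psi> \<odot> \<phi>)"
  and char_mult_left_commute: "\<chi> \<odot> (\<psi> \<odot> \<phi>) = \<psi> \<odot> (\<chi> \<odot> \<phi>)"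
  and char_inv_mult: "char_inv (\<chi> \<odot> \<psi>) = char_inv \<chi> \<odot> char_inv \<psi>"
  and char_inv_inv: "char_inv (char_inv \<chi>) = \<chi>"
  by (auto simp: fun_eq_iff char_mult_def char_inv_def)

lemmas char_mult_ac = char_mult_assoc char_mult_commute char_mult_left_commute

lemma char_mult_inv_right: "\<chi> \<in> mult_chars \<Longrightarrow> \<chi> \<odot> char_inv \<chi> = trivial_char"
  by (auto simp: fun_eq_iff char_mult_def char_inv_def trivial_char_def
      mult_char_0 mult_char_nonzero)

lemma char_mult_trivial: "\<chi> \<in> mult_chars \<Longrightarrow> \<chi> \<odot> trivial_char = \<chi>"
  by (auto simp: fun_eq_iff char_mult_def trivial_char_def mult_char_0)

lemma char_mult_eq_trivial_imp_inv:
  assumes "\<chi> \<in> mult_chars" "\<psi> \<in> mult_chars" "\<chi> \<odot> \<psi> = trivial_char"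
  shows "\<psi> = char_inv \<chi>"
proof
  fix x
  have "\<chi> x * \<psi> x = trivial_char x"
    using assms(3) by (metis char_mult_def)
  then show "\<psi> x = char_inv \<chi> x"
    using mult_char_0[OF assms(1)] mult_char_0[OF assms(2)] mult_char_nonzero[OF assms(1)]
    by (cases "x = 0") (auto simp: trivial_char_def char_inv_def field_simps)
qed

lemma char_delta_inv: "char_delta (char_inv \<chi>) = char_delta \<chi>"
proof -
  have "char_inv trivial_char = trivial_char"
    by (auto simp: fun_eq_iff char_inv_def trivial_char_def)
  then have "char_inv \<chi> = trivial_char \<longleftrightarrow> \<chi> = trivial_char"
    by (metis char_inv_inv)
  then show ?thesis by (simp add: char_delta_def)
qed

section \<open>Finiteness of the character group, and characters separating points\<close>

lemma card_field_ge_2: "CARD('a :: {finite, field}) \<ge> 2"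
proof -
  have "card {0 :: 'a, 1} \<le> CARD('a)" by (rule card_mono) auto
  then show ?thesis by simp
qed

lemma of_nat_card_field_minus_1_neq_0:
  "of_nat CARD('a :: {finite, field}) - 1 \<noteq> (0 :: complex)"
  using card_field_ge_2[where ?'a = 'a] by auto

text \<open>Multiplication by \<open>x\<close> permutes the nonzero elements, so their product
  equals itself times the power in question; that product is nonzero and cancels.\<close>

lemma power_card_minus_1_eq_1:
  fixes x :: "'a :: {finite, field}"
  assumes "x \<noteq> 0"
  shows "x ^ (CARD('a) - 1) = 1"
proof -
  let ?S = "UNIV - {0 :: 'a}"
  have "(\<Prod>y\<in>?S. x * y) = \<Prod>?S"
    by (rule prod.reindex_bij_witness[where i = "\<lambda>y. y / x" and j = "\<lambda>y. x * y"])
       (use assms in auto)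
  moreover have "(\<Prod>y\<in>?S. x * y) = x ^ card ?S * \<Prod>?S"
    by (simp add: prod.distrib)
  moreover have "\<Prod>?S \<noteq> 0" by simp
  ultimately show ?thesis by (simp add: card_Diff_singleton)
qed

text \<open>All values of a character are 0 or roots of unity of order dividing q - 1, and there are
  only finitely many functions between finite sets.\<close>

lemma finite_mult_chars: "finite (mult_chars :: ('a :: {finite, field} \<Rightarrow> complex) set)"
proof -
  let ?N = "CARD('a) - 1"
  have "mult_chars \<subseteq> {\<chi> :: 'a \<Rightarrow> complex. range \<chi> \<subseteq> insert 0 {z. z ^ ?N = 1}}"
  proof (rule subsetI, rule CollectI, rule image_subsetI)
    fix \<chi> :: "'a \<Rightarrow> complex" and x :: 'a
    assume "\<chi> \<in> mult_chars"
    then show "\<chi> x \<in> insert 0 {z. z ^ ?N = 1}"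
      using power_card_minus_1_eq_1[of x] mult_char_power[of \<chi> x ?N]
      by (cases "x = 0") (simp_all add: mult_char_0 mult_char_1)
  qed
  moreover have "finite {z :: complex. z ^ ?N = 1}"
    using card_field_ge_2[where ?'a = 'a] by (intro finite_roots_unity) simp
  then have "finite {\<chi> :: 'a \<Rightarrow> complex. range \<chi> \<subseteq> insert 0 {z. z ^ ?N = 1}}"
    using finite_set_of_finite_funs[of "UNIV :: 'a set" "insert 0 {z :: complex. z ^ ?N = 1}"]
    by (simp add: image_subset_iff)
  ultimately show ?thesis by (rule finite_subset)
qed

text \<open>The multiplicative group of a finite field is cyclic. The library states this for rings
  with a carrier, so the type is wrapped as the record \<open>R\<close> and the generator is carried
  back.\<close>

lemma ex_primitive_element: "\<exists>\<gamma> :: 'a :: {finite, field}. \<forall>x. x \<noteq> 0 \<longrightarrow> (\<exists>i :: nat. x = \<gamma> ^ i)"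
proof -
  define R :: "'a ring" where
    "R = \<lparr>carrier = UNIV, monoid.mult = (*), one = 1, zero = 0, add = (+)\<rparr>"
  have "field R"
  proof (intro field.intro domain.intro cringI abelian_groupI comm_monoidI domain_axioms.intro
      field_axioms.intro)
    show "Units R = carrier R - {\<zero>\<^bsub>R\<^esub>}"
      unfolding Units_def R_def by (auto intro: exI[of _ "inverse _"] simp: field_simps)
  qed (auto simp: R_def algebra_simps intro: exI[of _ "- _"])
  then interpret R: field R .
  have pow: "\<gamma> [^]\<^bsub>R\<^esub> i = \<gamma> ^ i" for \<gamma> :: 'a and i :: nat
    by (induction i) (simp_all add: R_def nat_pow_def mult.commute)
  show ?thesis
  proof -
    obtain \<gamma> where "carrier (mult_of R) = {\<gamma> [^]\<^bsub>R\<^esub> i | i :: nat. i \<in> UNIV}"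
      using R.finite_field_mult_group_has_gen by (auto simp: R_def)
    then have "UNIV - {0} = {\<gamma> ^ i | i :: nat. i \<in> UNIV}"
      unfolding pow by (simp add: R_def)
    then show ?thesis by blast
  qed
qed

text \<open>Discrete logarithm to a primitive base, followed by powers of a primitive root of unity
  of order q - 1, is a character that takes the value 1 only at 1.\<close>

lemma ex_mult_char_neq_1:
  fixes t :: "'a :: {finite, field}"
  assumes "t \<noteq> 0" "t \<noteq> 1"
  shows "\<exists>\<chi>\<in>mult_chars. \<chi> t \<noteq> 1"
proof -
  define N where "N = CARD('a) - 1"
  have N: "N > 0" using card_field_ge_2[where ?'a = 'a] by (simp add: N_def)
  obtain \<gamma> :: 'a where \<gamma>: "\<And>x. x \<noteq> 0 \<Longrightarrow> \<exists>i :: nat. x = \<gamma> ^ i"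
    using ex_primitive_element by blast
  \<comment> \<open>In the field with two elements 0 also has the property assumed of
    \<open>\<gamma>\<close>, since 0 ^ 0 = 1. A \<open>t\<close> other than 0 and 1 rules this
    out.\<close>
  have "\<gamma> \<noteq> 0"
  proof
    assume "\<gamma> = 0"
    then show False using \<gamma>[OF assms(1)] assms by (metis power_0_left)
  qed
  then have pow_mod: "\<gamma> ^ (i mod N) = \<gamma> ^ i" for i
    using power_card_minus_1_eq_1[of \<gamma>] div_mult_mod_eq[of i N]
    by (metis N_def mult_1 power_add power_mult power_one mult.commute)
  have img: "(\<lambda>i. \<gamma> ^ i) ` {..<N} = UNIV - {0}"
  proof (intro equalityI subsetI)
    fix x :: 'a assume "x \<in> UNIV - {0}"
    then obtain i where "x = \<gamma> ^ i" using \<gamma> by auto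
    then have "x = \<gamma> ^ (i mod N)" by (simp add: pow_mod)
    then show "x \<in> (\<lambda>i. \<gamma> ^ i) ` {..<N}" using N by auto
  qed (use \<open>\<gamma> \<noteq> 0\<close> in auto)
  \<comment> \<open>The image has exactly \<open>N\<close> elements, as many as the index set, so
    the map is injective.\<close>
  have inj: "inj_on (\<lambda>i. \<gamma> ^ i) {..<N}"
    by (rule eq_card_imp_inj_on) (simp, simp only: img, simp add: N_def card_Diff_singleton)
  define dlog where "dlog = inv_into {..<N} (\<lambda>i. \<gamma> ^ i)"
  have dlog: "dlog x < N" "\<gamma> ^ dlog x = x" if "x \<noteq> 0" for x
  proof -
    have x: "x \<in> (\<lambda>i. \<gamma> ^ i) ` {..<N}" using that img by auto
    show "dlog x < N" using inv_into_into[OF x] by (simp add: dlog_def)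
    show "\<gamma> ^ dlog x = x" using f_inv_into_f[OF x] by (simp add: dlog_def)
  qed
  have dlog_eqI: "dlog x = i" if "i < N" "\<gamma> ^ i = x" for i x
    using inv_into_f_f[OF inj, of i] that by (simp add: dlog_def)
  define \<zeta> where "\<zeta> = cis (2 * pi / N)"
  have zpow: "\<zeta> ^ i = cis (2 * pi * real i / real N)" for i
    by (simp add: \<zeta>_def DeMoivre mult_ac)
  have zN: "\<zeta> ^ N = 1" using N by (simp add: zpow)
  then have zpow_mod: "\<zeta> ^ (i mod N) = \<zeta> ^ i" for i
    using div_mult_mod_eq[of i N] by (metis mult_1 power_add power_mult power_one mult.commute)
  define \<chi> where "\<chi> x = (if x = 0 then 0 else \<zeta> ^ dlog x)" for x
  have "\<zeta> \<noteq> 0" by (simp add: \<zeta>_def)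
  have "\<chi> \<in> mult_chars"
  proof -
    \<comment> \<open>The logarithm is additive only modulo \<open>N\<close>; the reduction is
      harmless because \<open>\<zeta> ^ N = 1\<close>.\<close>
    have "dlog (x * y) = (dlog x + dlog y) mod N" if "x \<noteq> 0" "y \<noteq> 0" for x y
      using that N by (intro dlog_eqI) (simp_all add: pow_mod power_add dlog)
    then show ?thesis
      using \<open>\<zeta> \<noteq> 0\<close> by (auto simp: mult_chars_def \<chi>_def zpow_mod power_add)
  qed
  moreover have "\<chi> t \<noteq> 1"
  proof
    assume "\<chi> t = 1"
    then have "cis (2 * pi * real (dlog t) / real N) = cis (2 * pi * real 0 / real N)"
      using assms by (simp add: \<chi>_def zpow)
    moreover have "inj_on (\<lambda>k. cis (2 * pi * real k / real N)) {..<N}"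
      using bij_betw_roots_unity[OF N] by (rule bij_betw_imp_inj_on)
    ultimately have "dlog t = 0"
      using dlog(1)[OF assms(1)] N by (meson inj_onD lessThan_iff)
    then show False using dlog(2)[OF assms(1)] assms by simp
  qed
  ultimately show ?thesis by blast
qed

section \<open>Orthogonality relations\<close>

text \<open>For nontrivial \<open>\<chi>\<close>, the substitution of \<open>y * x\<close> for
  \<open>x\<close> with \<open>\<chi> y \<noteq> 1\<close> multiplies the sum by
  \<open>\<chi> y\<close>, so the sum is 0.\<close>

lemma sum_mult_char:
  fixes \<chi> :: "'a :: {finite, field} \<Rightarrow> complex"
  assumes "\<chi> \<in> mult_chars"
  shows "(\<Sum>x\<in>UNIV. \<chi> x) = (of_nat CARD('a) - 1) * char_delta \<chi>"
proof (cases "\<chi> = trivial_char")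
  case True
  have "(\<Sum>x\<in>UNIV. trivial_char (x :: 'a)) = (\<Sum>x\<in>UNIV - {0 :: 'a}. 1)"
    by (rule sum.mono_neutral_cong_right) (auto simp: trivial_char_def)
  also have "\<dots> = of_nat CARD('a) - 1"
    by (simp add: card_Diff_singleton of_nat_diff Suc_leI)
  finally show ?thesis using True by (simp add: char_delta_def)
next
  case False
  then obtain y where y: "y \<noteq> 0" "\<chi> y \<noteq> 1"
    using mult_char_0[OF assms] by (auto simp: fun_eq_iff trivial_char_def split: if_splits)
  have "(\<Sum>x\<in>UNIV. \<chi> x) = (\<Sum>x\<in>UNIV. \<chi> (y * x))"
    by (rule sum.reindex_bij_witness[where i = "\<lambda>x. y * x" and j = "\<lambda>x. x / y"])
       (use y in auto)
  also have "\<dots> = \<chi> y * (\<Sum>x\<in>UNIV. \<chi> x)"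
    by (simp add: mult_char_mult[OF assms] sum_distrib_left)
  finally show ?thesis using y False by (simp add: char_delta_def)
qed

text \<open>The dual shift: multiplying the summation variable by a character that separates
  \<open>t\<close> from 1 rescales the sum. At \<open>t = 0\<close> every term vanishes.\<close>

lemma sum_mult_chars_eq_0:
  fixes t :: "'a :: {finite, field}"
  assumes "t \<noteq> 1"
  shows "(\<Sum>\<psi>\<in>mult_chars. \<psi> t) = 0"
proof (cases "t = 0")
  case False
  then obtain \<chi> where \<chi>: "\<chi> \<in> mult_chars" "\<chi> t \<noteq> 1"
    using ex_mult_char_neq_1 assms by blast
  have "(\<Sum>\<psi>\<in>mult_chars. \<psi> t) = (\<Sum>\<psi>\<in>mult_chars. (\<chi> \<odot> \<psi>) t)"
  proof (rule sum.reindex_bij_witness[where i = "\<lambda>\<psi>. \<chi> \<odot> \<psi>" and j = "\<lambda>\<psi>. char_inv \<chi> \<odot> \<psi>"])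
    fix \<psi> :: "'a \<Rightarrow> complex" assume \<psi>: "\<psi> \<in> mult_chars"
    have *: "\<chi> \<odot> char_inv \<chi> \<odot> \<psi> = \<psi>"
      using \<chi> \<psi> by (simp add: char_mult_inv_right char_mult_commute[of trivial_char] char_mult_trivial)
    then show "\<chi> \<odot> (char_inv \<chi> \<odot> \<psi>) = \<psi>" by (simp add: char_mult_assoc)
    then show "(\<chi> \<odot> (char_inv \<chi> \<odot> \<psi>)) t = \<psi> t" by simp
    show "char_inv \<chi> \<odot> (\<chi> \<odot> \<psi>) = \<psi>" using * by (simp add: char_mult_ac)
  qed (use \<chi> in \<open>auto intro: mult_chars_closed\<close>)
  also have "\<dots> = \<chi> t * (\<Sum>\<psi>\<in>mult_chars. \<psi> t)"
    by (simp add: char_mult_def sum_distrib_left)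
  finally show ?thesis using \<chi> by simp
qed (simp add: mult_char_0)

text \<open>At \<open>t = 1\<close> this counts the characters. The count comes from summing
  \<open>\<psi> t\<close> over all \<open>\<psi>\<close> and \<open>t\<close> in both orders: one
  order leaves only \<open>t = 1\<close>, the other only the trivial character.\<close>

lemma sum_mult_chars:
  fixes t :: "'a :: {finite, field}"
  shows "(\<Sum>\<psi>\<in>mult_chars. \<psi> t) = (if t = 1 then of_nat CARD('a) - 1 else 0)"
proof (cases "t = 1")
  case True
  have "(\<Sum>\<psi>\<in>mult_chars. \<psi> (1 :: 'a)) = (\<Sum>t\<in>UNIV. \<Sum>\<psi>\<in>mult_chars. \<psi> (t :: 'a))"
    by (subst sum.remove[of _ 1]) (auto simp: sum_mult_chars_eq_0)
  also have "\<dots> = (\<Sum>\<psi>\<in>mult_chars. \<Sum>t\<in>UNIV. \<psi> (t :: 'a))"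
    by (rule sum.swap)
  also have "\<dots> = (\<Sum>\<psi>\<in>mult_chars. (of_nat CARD('a) - 1) * char_delta (\<psi> :: 'a \<Rightarrow> complex))"
    by (simp add: sum_mult_char)
  also have "\<dots> = of_nat CARD('a) - 1"
    by (subst sum.remove[of _ trivial_char])
       (auto simp: finite_mult_chars trivial_char_in_mult_chars char_delta_def)
  finally show ?thesis using True by simp
qed (simp add: sum_mult_chars_eq_0)

section \<open>Gauss sums: twisting, products and reflection\<close>

context
  fixes \<theta> :: "'a :: {finite, field} \<Rightarrow> complex"
  assumes \<theta>: "nontrivial_add_char \<theta>"
begin

lemma add_char_add: "\<theta> (x + y) = \<theta> x * \<theta> y"
  using \<theta> by (simp add: nontrivial_add_char_def add_char_def)

lemma add_char_0: "\<theta> 0 = 1"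
proof -
  have "\<theta> 0 \<noteq> 0" using \<theta> by (simp add: nontrivial_add_char_def add_char_def)
  then show ?thesis using add_char_add[of 0 0] by simp
qed

lemma sum_add_char: "(\<Sum>x\<in>UNIV. \<theta> x) = 0"
proof -
  obtain y where y: "\<theta> y \<noteq> 1" using \<theta> by (auto simp: nontrivial_add_char_def)
  have "(\<Sum>x\<in>UNIV. \<theta> x) = (\<Sum>x\<in>UNIV. \<theta> (y + x))"
    by (rule sum.reindex_bij_witness[where i = "\<lambda>x. y + x" and j = "\<lambda>x. x - y"]) auto
  also have "\<dots> = \<theta> y * (\<Sum>x\<in>UNIV. \<theta> x)"
    by (simp add: add_char_add sum_distrib_left)
  finally show ?thesis using y by simp
qed

text \<open>The trivial character vanishes at 0, which removes the term
  \<open>\<theta> 0 = 1\<close> from a full sum equal to 0.\<close>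

lemma gauss_sum_trivial: "gauss_sum \<theta> trivial_char = - 1"
proof -
  have "gauss_sum \<theta> trivial_char = (\<Sum>x\<in>UNIV - {0}. \<theta> x)"
    unfolding gauss_sum_def
    by (rule sum.mono_neutral_cong_right) (auto simp: trivial_char_def)
  also have "\<dots> = (\<Sum>x\<in>UNIV. \<theta> x) - \<theta> 0"
    by (simp add: sum_diff1)
  finally show ?thesis by (simp add: sum_add_char add_char_0)
qed

text \<open>For \<open>s \<noteq> 0\<close> the substitution of \<open>x / s\<close> for
  \<open>x\<close> pulls out the character value; for \<open>s = 0\<close> a plain character sum
  remains. This exceptional case is the source of the later delta terms.\<close>

lemma twisted_gauss_sum:
  assumes "\<chi> \<in> mult_chars"
  shows "(\<Sum>x\<in>UNIV. \<chi> x * \<theta> (s * x)) =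
    (if s = 0 then (of_nat CARD('a) - 1) * char_delta \<chi> else char_inv \<chi> s * gauss_sum \<theta> \<chi>)"
proof (cases "s = 0")
  case True
  then show ?thesis using sum_mult_char[OF assms] by (simp add: add_char_0)
next
  case False
  have "(\<Sum>x\<in>UNIV. \<chi> x * \<theta> (s * x)) = (\<Sum>x\<in>UNIV. \<chi> (inverse s * x) * \<theta> x)"
    by (rule sum.reindex_bij_witness[where i = "\<lambda>x. x / s" and j = "\<lambda>x. s * x"])
       (use False in \<open>auto simp flip: mult.assoc\<close>)
  also have "\<dots> = char_inv \<chi> s * gauss_sum \<theta> \<chi>"
    by (simp add: mult_char_mult[OF assms] mult_char_inverse[OF assms] gauss_sum_def char_inv_def
        sum_distrib_left mult_ac)
  finally show ?thesis using False by simp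
qed

text \<open>In the double sum over \<open>x\<close> and \<open>y\<close>, put
  \<open>y = t * x\<close>. This is a bijection for each \<open>x \<noteq> 0\<close>, and the terms
  with \<open>x = 0\<close> vanish.\<close>

lemma gauss_sum_mult:
  assumes "\<chi> \<in> mult_chars" "\<phi> \<in> mult_chars"
  shows "gauss_sum \<theta> \<chi> * gauss_sum \<theta> \<phi> =
    (\<Sum>t\<in>UNIV. \<phi> t * (\<Sum>x\<in>UNIV. (\<chi> \<odot> \<phi>) x * \<theta> ((1 + t) * x)))"
proof -
  have inner: "\<chi> x * \<theta> x * gauss_sum \<theta> \<phi> = (\<Sum>t\<in>UNIV. \<phi> t * ((\<chi> \<odot> \<phi>) x * \<theta> ((1 + t) * x)))" for x
  proof (cases "x = 0")
    case True
    then show ?thesis by (simp add: mult_char_0[OF assms(1)] char_mult_def)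
  next
    case False
    have "gauss_sum \<theta> \<phi> = (\<Sum>t\<in>UNIV. \<phi> (t * x) * \<theta> (t * x))"
      unfolding gauss_sum_def
      by (rule sum.reindex_bij_witness[where i = "\<lambda>t. t * x" and j = "\<lambda>y. y / x"])
         (use False in auto)
    moreover have "\<theta> ((1 + t) * x) = \<theta> x * \<theta> (t * x)" for t
      by (simp add: distrib_right add_char_add)
    ultimately show ?thesis
      by (simp add: sum_distrib_left mult_char_mult[OF assms(2)] char_mult_def mult_ac)
  qed
  have "gauss_sum \<theta> \<chi> * gauss_sum \<theta> \<phi> = (\<Sum>x\<in>UNIV. \<chi> x * \<theta> x * gauss_sum \<theta> \<phi>)"
    by (simp add: gauss_sum_def[of \<theta> \<chi>] sum_distrib_right)
  also have "\<dots> = (\<Sum>t\<in>UNIV. \<Sum>x\<in>UNIV. \<phi> t * ((\<chi> \<odot> \<phi>) x * \<theta> ((1 + t) * x)))"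
    unfolding inner by (rule sum.swap)
  finally show ?thesis by (simp add: sum_distrib_left)
qed

text \<open>In the product formula for \<open>char_inv \<chi>\<close> and \<open>\<chi>\<close> the
  inner sum belongs to the trivial character, hence is q - 1 at \<open>t = - 1\<close> and -1
  elsewhere.\<close>

lemma gauss_sum_reflection:
  assumes "\<chi> \<in> mult_chars"
  shows "gauss_sum \<theta> \<chi> * gauss_sum \<theta> (char_inv \<chi>) =
    of_nat CARD('a) * \<chi> (- 1) - (of_nat CARD('a) - 1) * char_delta \<chi>"
proof -
  let ?q = "of_nat CARD('a) :: complex"
  have "(\<Sum>x\<in>UNIV. trivial_char x * \<theta> ((1 + t) * x)) = (if t = - 1 then ?q else 0) - 1" for t
    using twisted_gauss_sum[OF trivial_char_in_mult_chars, of "1 + t"]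
    by (auto simp: gauss_sum_trivial char_delta_def char_inv_def trivial_char_def add_eq_0_iff)
  moreover have "char_inv \<chi> \<odot> \<chi> = trivial_char"
    using char_mult_inv_right[OF assms] by (simp add: char_mult_commute)
  ultimately have "gauss_sum \<theta> (char_inv \<chi>) * gauss_sum \<theta> \<chi> =
      (\<Sum>t\<in>UNIV. \<chi> t * ((if t = - 1 then ?q else 0) - 1))"
    using gauss_sum_mult[OF char_inv_in_mult_chars[OF assms] assms] by simp
  also have "\<dots> = (\<Sum>t\<in>UNIV. if t = - 1 then ?q * \<chi> t else 0) - (\<Sum>t\<in>UNIV. \<chi> t)"
    unfolding sum_subtractf[symmetric] by (rule sum.cong) (auto simp: algebra_simps)
  finally show ?thesis by (simp add: sum_mult_char[OF assms] mult.commute)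
qed

text \<open>If the sum vanished, reflection would give q = q - 1 for the trivial character and
  \<open>\<chi> (- 1) = 0\<close> for any other. The theorem needs this to cancel Gauss sums against
  denominators.\<close>

lemma gauss_sum_nonzero:
  assumes "\<chi> \<in> mult_chars"
  shows "gauss_sum \<theta> \<chi> \<noteq> 0"
proof
  assume "gauss_sum \<theta> \<chi> = 0"
  then have "of_nat CARD('a) * \<chi> (- 1) = (of_nat CARD('a) - 1) * char_delta \<chi>"
    using gauss_sum_reflection[OF assms] by simp
  then show False
    using mult_char_nonzero[OF assms, of "- 1"]
    by (auto simp: char_delta_def trivial_char_def split: if_splits)
qed

section \<open>The finite field analogue of Barnes' first lemma\<close>

lemma sum_gauss_sum_product:
  assumes "a \<in> mult_chars" "b \<in> mult_chars" "c \<in> mult_chars" "d \<in> mult_chars"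
  shows "(\<Sum>\<psi>\<in>mult_chars. gauss_sum \<theta> (a \<odot> \<psi>) * gauss_sum \<theta> (b \<odot> \<psi>) *
      gauss_sum \<theta> (c \<odot> char_inv \<psi>) * gauss_sum \<theta> (d \<odot> char_inv \<psi>)) =
    (of_nat CARD('a) - 1) * (\<Sum>t\<in>UNIV. (b \<odot> d) t *
      ((\<Sum>x\<in>UNIV. (a \<odot> d) x * \<theta> ((1 + t) * x)) * (\<Sum>x\<in>UNIV. (b \<odot> c) x * \<theta> ((1 + t) * x))))"
proof -
  define K where "K \<chi> t = (\<Sum>x\<in>UNIV. \<chi> x * \<theta> ((1 + t) * x))" for \<chi> t
  have cancel: "\<chi> \<odot> \<psi> \<odot> (\<phi> \<odot> char_inv \<psi>) = \<chi> \<odot> \<phi>"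
    if "\<chi> \<in> mult_chars" "\<phi> \<in> mult_chars" "\<psi> \<in> mult_chars" for \<chi> \<phi> \<psi> :: "'a \<Rightarrow> complex"
  proof -
    have "\<chi> \<odot> \<psi> \<odot> (\<phi> \<odot> char_inv \<psi>) = \<chi> \<odot> \<phi> \<odot> (\<psi> \<odot> char_inv \<psi>)"
      by (simp add: char_mult_ac)
    then show ?thesis using that by (simp add: char_mult_inv_right char_mult_trivial mult_chars_closed)
  qed
  \<comment> \<open>Each pair joins a factor containing \<open>\<psi>\<close> with one containing
    its inverse, so \<open>\<psi>\<close> drops out of the inner sums \<open>K\<close> and survives
    only in the outer values at \<open>t\<close> and \<open>u\<close>.\<close>
  have 1: "gauss_sum \<theta> (a \<odot> \<psi>) * gauss_sum \<theta> (d \<odot> char_inv \<psi>) =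
      (\<Sum>t\<in>UNIV. (d \<odot> char_inv \<psi>) t * K (a \<odot> d) t)"
    and 2: "gauss_sum \<theta> (c \<odot> char_inv \<psi>) * gauss_sum \<theta> (b \<odot> \<psi>) =
      (\<Sum>u\<in>UNIV. (b \<odot> \<psi>) u * K (b \<odot> c) u)" if "\<psi> \<in> mult_chars" for \<psi>
    using that assms gauss_sum_mult[of "a \<odot> \<psi>" "d \<odot> char_inv \<psi>"]
      gauss_sum_mult[of "c \<odot> char_inv \<psi>" "b \<odot> \<psi>"] cancel[of a d \<psi>] cancel[of b c \<psi>]
    by (simp_all add: K_def mult_chars_closed char_mult_commute[of "c \<odot> char_inv \<psi>"])
  \<comment> \<open>For \<open>t \<noteq> 0\<close>, what depends on \<open>\<psi>\<close> is its
    value at \<open>u / t\<close>, so orthogonality leaves only the diagonal.\<close>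
  have orth: "(\<Sum>\<psi>\<in>mult_chars. (d \<odot> char_inv \<psi>) t * (b \<odot> \<psi>) u) =
      (if u = t then (of_nat CARD('a) - 1) * (b \<odot> d) t else 0)" for t u
  proof (cases "t = 0")
    case True
    then show ?thesis by (simp add: char_mult_def mult_char_0 assms)
  next
    case False
    have "(\<Sum>\<psi>\<in>mult_chars. (d \<odot> char_inv \<psi>) t * (b \<odot> \<psi>) u) =
        d t * b u * (\<Sum>\<psi>\<in>mult_chars. \<psi> (u * inverse t))"
      unfolding sum_distrib_left
      by (rule sum.cong) (simp_all add: char_mult_def char_inv_def mult_char_mult mult_char_inverse mult_ac)
    also have "u * inverse t = 1 \<longleftrightarrow> u = t" using False by (auto simp: field_simps)
    then have "d t * b u * (\<Sum>\<psi>\<in>mult_chars. \<psi> (u * inverse t)) =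
        (if u = t then (of_nat CARD('a) - 1) * (b \<odot> d) t else 0)"
      by (simp add: sum_mult_chars char_mult_def mult_ac)
    finally show ?thesis .
  qed
  have "(\<Sum>\<psi>\<in>mult_chars. gauss_sum \<theta> (a \<odot> \<psi>) * gauss_sum \<theta> (b \<odot> \<psi>) *
      gauss_sum \<theta> (c \<odot> char_inv \<psi>) * gauss_sum \<theta> (d \<odot> char_inv \<psi>)) =
    (\<Sum>\<psi>\<in>mult_chars. (gauss_sum \<theta> (a \<odot> \<psi>) * gauss_sum \<theta> (d \<odot> char_inv \<psi>)) *
      (gauss_sum \<theta> (c \<odot> char_inv \<psi>) * gauss_sum \<theta> (b \<odot> \<psi>)))"
    by (simp add: mult_ac)
  also have "\<dots> = (\<Sum>\<psi>\<in>mult_chars. \<Sum>t\<in>UNIV. \<Sum>u\<in>UNIV.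
      ((d \<odot> char_inv \<psi>) t * (b \<odot> \<psi>) u) * (K (a \<odot> d) t * K (b \<odot> c) u))"
    by (rule sum.cong) (simp, simp only: 1 2 sum_product, simp add: mult_ac)
  also have "\<dots> = (\<Sum>t\<in>UNIV. \<Sum>\<psi>\<in>mult_chars. \<Sum>u\<in>UNIV.
      ((d \<odot> char_inv \<psi>) t * (b \<odot> \<psi>) u) * (K (a \<odot> d) t * K (b \<odot> c) u))"
    by (rule sum.swap)
  also have "\<dots> = (\<Sum>t\<in>UNIV. \<Sum>u\<in>UNIV. \<Sum>\<psi>\<in>mult_chars.
      ((d \<odot> char_inv \<psi>) t * (b \<odot> \<psi>) u) * (K (a \<odot> d) t * K (b \<odot> c) u))"
    by (intro sum.cong refl sum.swap)
  also have "\<dots> = (\<Sum>t\<in>UNIV. \<Sum>u\<in>UNIV. if u = t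
      then (of_nat CARD('a) - 1) * (b \<odot> d) t * (K (a \<odot> d) t * K (b \<odot> c) t) else 0)"
    by (intro sum.cong refl) (simp add: orth flip: sum_distrib_right)
  also have "\<dots> = (of_nat CARD('a) - 1) * (\<Sum>t\<in>UNIV. (b \<odot> d) t * (K (a \<odot> d) t * K (b \<odot> c) t))"
    by (simp add: sum_distrib_left mult_ac)
  finally show ?thesis by (simp add: K_def)
qed

lemma gauss_sum_barnes:
  assumes "a \<in> mult_chars" "b \<in> mult_chars" "c \<in> mult_chars" "d \<in> mult_chars"
  shows "gauss_sum \<theta> (a \<odot> c) * gauss_sum \<theta> (a \<odot> d) * gauss_sum \<theta> (b \<odot> c) * gauss_sum \<theta> (b \<odot> d) =
    gauss_sum \<theta> (a \<odot> b \<odot> c \<odot> d) * (1 / (of_nat CARD('a) - 1)) *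
      (\<Sum>\<psi>\<in>mult_chars. gauss_sum \<theta> (a \<odot> \<psi>) * gauss_sum \<theta> (b \<odot> \<psi>) *
        gauss_sum \<theta> (c \<odot> char_inv \<psi>) * gauss_sum \<theta> (d \<odot> char_inv \<psi>)) +
    of_nat CARD('a) * (of_nat CARD('a) - 1) * (b \<odot> a) (- 1) * char_delta (a \<odot> b \<odot> c \<odot> d)"
proof -
  define K where "K \<chi> t = (\<Sum>x\<in>UNIV. \<chi> x * \<theta> ((1 + t) * x))" for \<chi> t
  define q :: complex where "q = of_nat CARD('a)"
  define \<eta> where "\<eta> = a \<odot> b \<odot> c \<odot> d"
  let ?g = "gauss_sum \<theta>"
  have mem: "a \<odot> c \<in> mult_chars" "a \<odot> d \<in> mult_chars" "b \<odot> c \<in> mult_chars" "b \<odot> d \<in> mult_chars"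
    "\<eta> \<in> mult_chars"
    using assms by (simp_all add: \<eta>_def mult_chars_closed)
  have K: "K \<chi> t = (if t = - 1 then (q - 1) * char_delta \<chi> else char_inv \<chi> (1 + t) * ?g \<chi>)"
    if "\<chi> \<in> mult_chars" for \<chi> t
    using twisted_gauss_sum[OF that, of "1 + t"] by (simp add: K_def q_def add_eq_0_iff)
  have \<eta>1: "\<eta> = (a \<odot> d) \<odot> (b \<odot> c)" and \<eta>2: "\<eta> = (a \<odot> c) \<odot> (b \<odot> d)"
    by (simp_all add: \<eta>_def char_mult_ac)
  \<comment> \<open>Away from \<open>t = - 1\<close> both sides agree because
    \<open>char_inv\<close> is multiplicative. The conditional term is the difference of the two
    sides at \<open>t = - 1\<close>.\<close>
  have pointwise: "?g \<eta> * (K (a \<odot> d) t * K (b \<odot> c) t) = K \<eta> t * (?g (a \<odot> d) * ?g (b \<odot> c)) +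
    (if t = - 1 then (q - 1) * ((q - 1) * ?g \<eta> * char_delta (a \<odot> d) * char_delta (b \<odot> c)
      - char_delta \<eta> * (?g (a \<odot> d) * ?g (b \<odot> c))) else 0)" for t
    using mem by (simp add: K) (simp add: \<eta>1 char_inv_mult char_mult_def algebra_simps)
  \<comment> \<open>If \<open>\<eta>\<close> is trivial, then \<open>b \<odot> c\<close> is inverse
    to \<open>a \<odot> d\<close>, and the delta term of the reflection formula cancels the first
    summand since \<open>gauss_sum \<theta> trivial_char = - 1\<close>. Otherwise
    \<open>a \<odot> d\<close> and \<open>b \<odot> c\<close> are not both trivial, and everything
    vanishes.\<close>
  have correction: "(q - 1) * ?g \<eta> * char_delta (a \<odot> d) * char_delta (b \<odot> c)
      - char_delta \<eta> * (?g (a \<odot> d) * ?g (b \<odot> c)) = - char_delta \<eta> * q * (a \<odot> d) (- 1)"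
  proof (cases "\<eta> = trivial_char")
    case True
    then have inv: "b \<odot> c = char_inv (a \<odot> d)"
      using char_mult_eq_trivial_imp_inv mem \<eta>1 by simp
    have "char_delta \<eta> = 1" and "char_delta (a \<odot> d) = 0 \<or> char_delta (a \<odot> d) = 1"
      using True by (simp_all add: char_delta_def)
    then show ?thesis
      using gauss_sum_reflection[OF mem(2)] gauss_sum_trivial
      by (auto simp: True inv char_delta_inv q_def)
  next
    case False
    have "\<not> (a \<odot> d = trivial_char \<and> b \<odot> c = trivial_char)"
      using False \<eta>1 by (auto simp: char_mult_trivial trivial_char_in_mult_chars)
    then show ?thesis using False by (auto simp: char_delta_def)
  qed
  have sign: "(b \<odot> d) (- 1) * (a \<odot> d) (- 1) = (b \<odot> a) (- 1)"
    using mult_char_minus_1_square[OF assms(4)] by (simp add: char_mult_def mult_ac)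
  let ?S = "\<Sum>t\<in>UNIV. (b \<odot> d) t * (K (a \<odot> d) t * K (b \<odot> c) t)"
  have "?g \<eta> * ?S = (\<Sum>t\<in>UNIV. (b \<odot> d) t * (?g \<eta> * (K (a \<odot> d) t * K (b \<odot> c) t)))"
    by (simp add: sum_distrib_left mult_ac)
  also have "\<dots> = (\<Sum>t\<in>UNIV. (b \<odot> d) t * K \<eta> t * (?g (a \<odot> d) * ?g (b \<odot> c)) +
      (if t = - 1 then - (q - 1) * q * char_delta \<eta> * (b \<odot> d) t * (a \<odot> d) (- 1) else 0))"
    unfolding pointwise correction by (rule sum.cong) (auto simp: algebra_simps)
  also have "\<dots> = (\<Sum>t\<in>UNIV. (b \<odot> d) t * K \<eta> t) * (?g (a \<odot> d) * ?g (b \<odot> c))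
      - q * (q - 1) * char_delta \<eta> * ((b \<odot> d) (- 1) * (a \<odot> d) (- 1))"
    by (simp add: sum.distrib flip: sum_distrib_right) (simp add: algebra_simps)
  also have "(\<Sum>t\<in>UNIV. (b \<odot> d) t * K \<eta> t) = ?g (a \<odot> c) * ?g (b \<odot> d)"
    using gauss_sum_mult[OF mem(1,4)] by (simp add: K_def \<eta>2)
  finally have "?g (a \<odot> c) * ?g (b \<odot> d) * (?g (a \<odot> d) * ?g (b \<odot> c)) =
      ?g \<eta> * ?S + q * (q - 1) * char_delta \<eta> * (b \<odot> a) (- 1)"
    by (simp add: sign)
  moreover have "?S = 1 / (q - 1) * (\<Sum>\<psi>\<in>mult_chars. ?g (a \<odot> \<psi>) * ?g (b \<odot> \<psi>) *
        ?g (c \<odot> char_inv \<psi>) * ?g (d \<odot> char_inv \<psi>))"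
    unfolding sum_gauss_sum_product[OF assms]
    using of_nat_card_field_minus_1_neq_0[where ?'a = 'a] by (simp add: K_def q_def)
  ultimately show ?thesis
    by (simp only: q_def \<eta>_def) (simp only: mult_ac)
qed

end

section \<open>The hypergeometric identity, by comparing coefficients\<close>

theorem theorem1p7:
  fixes \<theta> :: "'a :: {finite, field} \<Rightarrow> complex"
    and A :: "nat \<Rightarrow> 'a \<Rightarrow> complex"
    and n :: nat
    and x :: 'a
  defines "q \<equiv> (of_nat CARD('a) :: complex)"
    and "g \<equiv> gauss_sum \<theta>"
    and "B \<equiv> (\<lambda>i. A 0 \<odot> char_inv (A i))"
  assumes "nontrivial_add_char \<theta>"
    and "n \<ge> 2"
    and "\<And>i. i \<le> n \<Longrightarrow> A i \<in> mult_chars"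
  shows "hyp_star \<theta> n A B x =
    g (char_inv (A 0) \<odot> A (n - 1) \<odot> A n) /
      (g (A (n - 1)) * g (A n) * g (char_inv (A 0) \<odot> A (n - 1)) * g (char_inv (A 0) \<odot> A n)) *
    (1 / (q - 1)) *
    (\<Sum>\<psi>\<in>mult_chars.
       g (A (n - 1) \<odot> \<psi>) * g (A n \<odot> \<psi>) * g (char_inv \<psi>) * g (char_inv (A 0) \<odot> char_inv \<psi>) *
       hyp_star \<theta> (n - 1) (A(n - 1 := char_inv \<psi>)) (B(n - 1 := A 0 \<odot> \<psi>)) (- x))
    + q * (q - 1) * (A n \<odot> A (n - 1)) (- 1) *
        char_delta (char_inv (A 0) \<odot> A (n - 1) \<odot> A n) /
      (g (A (n - 1)) * g (A n) * g (char_inv (A 0) \<odot> A (n - 1)) * g (char_inv (A 0) \<odot> A n)) *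
      hyp_star \<theta> (n - 2) A B x"
proof -
  obtain m where n: "n = Suc (Suc m)"
    using \<open>n \<ge> 2\<close> by (metis Suc_le_D numeral_2_eq_2 Suc_le_mono)
  have n1: "n - 1 = Suc m" and n2: "n - 2 = m" by (simp_all add: n)
  define a b c where "a = A (Suc m)" and "b = A n" and "c = char_inv (A 0)"
  have mem: "a \<in> mult_chars" "b \<in> mult_chars" "c \<in> mult_chars"
    using assms(6) by (simp_all add: a_def b_def c_def n char_inv_in_mult_chars)
  have g_nz: "g \<chi> \<noteq> 0" if "\<chi> \<in> mult_chars" for \<chi>
    unfolding g_def using \<open>nontrivial_add_char \<theta>\<close> that by (rule gauss_sum_nonzero)
  define D where "D = g a * g b * g (c \<odot> a) * g (c \<odot> b)"
  \<comment> \<open>\<open>C \<chi>\<close> is the summand of the smallest hypergeometric function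
    on the right, and it is a factor of the summands of the other two. \<open>W \<chi>\<close> below
    is the Barnes sum with third and fourth parameters \<open>\<chi>\<close> and
    \<open>c \<odot> char_inv \<chi>\<close>.\<close>
  define C where "C \<chi> = (\<Prod>i=0..m. g (A i \<odot> \<chi>) / g (A i)) *
      (\<Prod>j=1..m. g (char_inv (B j \<odot> \<chi>)) / g (char_inv (B j))) *
      g (char_inv \<chi>) * \<chi> (- 1) ^ (m + 1) * \<chi> x" for \<chi>
  define W where "W \<chi> = (\<Sum>\<psi>\<in>mult_chars. g (a \<odot> \<psi>) * g (b \<odot> \<psi>) *
      g (\<chi> \<odot> char_inv \<psi>) * g (c \<odot> char_inv \<chi> \<odot> char_inv \<psi>))" for \<chi>
  have hyp_m: "hyp_star \<theta> m A B x = 1 / (q - 1) * (\<Sum>\<chi>\<in>mult_chars. C \<chi>)"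
    by (simp add: hyp_star_def C_def q_def g_def)
  have prod_Suc: "(\<Prod>j=1..Suc k. f j) = (\<Prod>j=1..k. f j) * f (Suc k)" for f :: "nat \<Rightarrow> complex" and k
    by simp
  have inv_B: "char_inv (B j) = c \<odot> A j"
    and inv_B_mult: "char_inv (B j \<odot> \<chi>) = A j \<odot> (c \<odot> char_inv \<chi>)" for j \<chi>
    by (simp_all add: B_def c_def char_inv_mult char_inv_inv char_mult_ac)
  have hyp_n: "hyp_star \<theta> n A B x = 1 / (q - 1) * (\<Sum>\<chi>\<in>mult_chars. C \<chi> *
      (g (a \<odot> \<chi>) * g (a \<odot> (c \<odot> char_inv \<chi>)) * g (b \<odot> \<chi>) * g (b \<odot> (c \<odot> char_inv \<chi>)) / D))"
  proof -
    have "(\<Prod>i=0..n. g (A i \<odot> \<chi>) / g (A i)) *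
        (\<Prod>j=1..n. g (char_inv (B j \<odot> \<chi>)) / g (char_inv (B j))) *
        g (char_inv \<chi>) * \<chi> (- 1) ^ (n + 1) * \<chi> x =
      C \<chi> * (g (a \<odot> \<chi>) * g (a \<odot> (c \<odot> char_inv \<chi>)) * g (b \<odot> \<chi>) *
        g (b \<odot> (c \<odot> char_inv \<chi>)) / D)" if "\<chi> \<in> mult_chars" for \<chi>
    proof -
      \<comment> \<open>The exponents differ by two, and \<open>\<chi> (- 1)\<close> squares to
        1.\<close>
      have sign: "\<chi> (- 1) ^ (n + 1) = \<chi> (- 1) ^ (m + 1)"
        using mult_char_minus_1_square[OF that] by (simp add: n mult.assoc[symmetric])
      show ?thesis
        unfolding sign
        by (simp add: n prod.atLeast0_atMost_Suc prod_Suc C_def D_def a_def b_def inv_B inv_B_mult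
            mult_ac)
    qed
    then show ?thesis
      by (simp add: hyp_star_def flip: q_def g_def)
  qed
  \<comment> \<open>The two prefactors are exactly the denominators contributed by the last upper
    and last lower parameter, and cancel them. The updates at \<open>Suc m\<close> leave the
    parameters up to \<open>m\<close> unchanged.\<close>
  have hyp_n1: "g (char_inv \<psi>) * g (c \<odot> char_inv \<psi>) *
      hyp_star \<theta> (Suc m) (A(Suc m := char_inv \<psi>)) (B(Suc m := A 0 \<odot> \<psi>)) (- x) =
      1 / (q - 1) * (\<Sum>\<chi>\<in>mult_chars. C \<chi> *
        (g (\<chi> \<odot> char_inv \<psi>) * g (c \<odot> char_inv \<chi> \<odot> char_inv \<psi>)))"
    if \<psi>: "\<psi> \<in> mult_chars" for \<psi>
  proof -
    let ?A = "A(Suc m := char_inv \<psi>)" and ?B = "B(Suc m := A 0 \<odot> \<psi>)"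
    have nz: "g (char_inv \<psi>) \<noteq> 0" "g (c \<odot> char_inv \<psi>) \<noteq> 0"
      using mem \<psi> by (auto intro!: g_nz mult_chars_closed)
    have inv: "char_inv (A 0 \<odot> \<psi>) = c \<odot> char_inv \<psi>"
      "char_inv (A 0 \<odot> \<psi> \<odot> \<chi>) = c \<odot> char_inv \<chi> \<odot> char_inv \<psi>"
      "char_inv \<psi> \<odot> \<chi> = \<chi> \<odot> char_inv \<psi>" for \<chi>
      by (simp_all add: c_def char_inv_mult char_mult_ac)
    have summand: "g (char_inv \<psi>) * g (c \<odot> char_inv \<psi>) * ((\<Prod>i=0..Suc m. g (?A i \<odot> \<chi>) / g (?A i)) *
        (\<Prod>j=1..Suc m. g (char_inv (?B j \<odot> \<chi>)) / g (char_inv (?B j))) *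
        g (char_inv \<chi>) * \<chi> (- 1) ^ (Suc m + 1) * \<chi> (- x)) =
      C \<chi> * (g (\<chi> \<odot> char_inv \<psi>) * g (c \<odot> char_inv \<chi> \<odot> char_inv \<psi>))"
      if "\<chi> \<in> mult_chars" for \<chi>
    proof -
      \<comment> \<open>The argument \<open>- x\<close> compensates for the one additional factor
        \<open>\<chi> (- 1)\<close>.\<close>
      have "\<chi> (- 1) * \<chi> (- x) = \<chi> x"
        using mult_char_mult[OF that, of "- 1" "- x"] by simp
      then have sign: "\<chi> (- 1) ^ (Suc m + 1) * \<chi> (- x) = \<chi> (- 1) ^ (m + 1) * \<chi> x"
        by (simp add: mult_ac)
      show ?thesis
        unfolding mult.assoc sign
        by (simp add: prod.atLeast0_atMost_Suc prod_Suc C_def inv nz)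
    qed
    show ?thesis
      unfolding hyp_star_def q_def[symmetric] g_def[symmetric]
      by (subst mult.left_commute, subst sum_distrib_left, rule arg_cong[where f = "(*) _"],
          rule sum.cong[OF refl], rule summand)
  qed
  have "(\<Sum>\<psi>\<in>mult_chars. g (a \<odot> \<psi>) * g (b \<odot> \<psi>) * g (char_inv \<psi>) * g (c \<odot> char_inv \<psi>) *
       hyp_star \<theta> (Suc m) (A(Suc m := char_inv \<psi>)) (B(Suc m := A 0 \<odot> \<psi>)) (- x))
    = (\<Sum>\<psi>\<in>mult_chars. g (a \<odot> \<psi>) * g (b \<odot> \<psi>) * (1 / (q - 1) * (\<Sum>\<chi>\<in>mult_chars. C \<chi> *
        (g (\<chi> \<odot> char_inv \<psi>) * g (c \<odot> char_inv \<chi> \<odot> char_inv \<psi>)))))"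
    by (rule sum.cong) (simp_all only: mult.assoc flip: hyp_n1)
  also have "\<dots> = (\<Sum>\<psi>\<in>mult_chars. \<Sum>\<chi>\<in>mult_chars. 1 / (q - 1) * (C \<chi> * (g (a \<odot> \<psi>) * g (b \<odot> \<psi>) *
        g (\<chi> \<odot> char_inv \<psi>) * g (c \<odot> char_inv \<chi> \<odot> char_inv \<psi>))))"
    by (simp add: sum_distrib_left mult_ac)
  also have "\<dots> = (\<Sum>\<chi>\<in>mult_chars. \<Sum>\<psi>\<in>mult_chars. 1 / (q - 1) * (C \<chi> * (g (a \<odot> \<psi>) * g (b \<odot> \<psi>) *
        g (\<chi> \<odot> char_inv \<psi>) * g (c \<odot> char_inv \<chi> \<odot> char_inv \<psi>))))"
    by (rule sum.swap)
  also have "\<dots> = 1 / (q - 1) * (\<Sum>\<chi>\<in>mult_chars. C \<chi> * W \<chi>)"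
    by (simp add: sum_distrib_left W_def)
  finally have sum_hyp: "(\<Sum>\<psi>\<in>mult_chars. g (a \<odot> \<psi>) * g (b \<odot> \<psi>) * g (char_inv \<psi>) *
       g (c \<odot> char_inv \<psi>) *
       hyp_star \<theta> (Suc m) (A(Suc m := char_inv \<psi>)) (B(Suc m := A 0 \<odot> \<psi>)) (- x)) =
       1 / (q - 1) * (\<Sum>\<chi>\<in>mult_chars. C \<chi> * W \<chi>)" .
  have barnes: "g (a \<odot> \<chi>) * g (a \<odot> (c \<odot> char_inv \<chi>)) * g (b \<odot> \<chi>) * g (b \<odot> (c \<odot> char_inv \<chi>)) =
      g (c \<odot> a \<odot> b) * (1 / (q - 1)) * W \<chi> + q * (q - 1) * (b \<odot> a) (- 1) * char_delta (c \<odot> a \<odot> b)"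
    if "\<chi> \<in> mult_chars" for \<chi>
  proof -
    \<comment> \<open>In the product of the four Barnes parameters \<open>\<chi>\<close> cancels.
      The Gauss sum and the delta term are thus the same for every \<open>\<chi>\<close> and can
      leave the sum.\<close>
    have "a \<odot> b \<odot> \<chi> \<odot> (c \<odot> char_inv \<chi>) = c \<odot> a \<odot> b \<odot> (\<chi> \<odot> char_inv \<chi>)"
      by (simp add: char_mult_ac)
    also have "\<dots> = c \<odot> a \<odot> b"
      using that mem by (simp add: char_mult_inv_right char_mult_trivial mult_chars_closed)
    finally show ?thesis
      using gauss_sum_barnes[OF \<open>nontrivial_add_char \<theta>\<close> mem(1,2) that, of "c \<odot> char_inv \<chi>"] mem that
      by (simp add: mult_chars_closed W_def g_def q_def)
  qed
  have "hyp_star \<theta> n A B x = 1 / (q - 1) * (\<Sum>\<chi>\<in>mult_chars. C \<chi> *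
      ((g (c \<odot> a \<odot> b) * (1 / (q - 1)) * W \<chi> +
        q * (q - 1) * (b \<odot> a) (- 1) * char_delta (c \<odot> a \<odot> b)) / D))"
    unfolding hyp_n sum_distrib_left by (intro sum.cong refl) (simp only: barnes)
  also have "\<dots> = g (c \<odot> a \<odot> b) / D * (1 / (q - 1)) * (1 / (q - 1) * (\<Sum>\<chi>\<in>mult_chars. C \<chi> * W \<chi>)) +
      q * (q - 1) * (b \<odot> a) (- 1) * char_delta (c \<odot> a \<odot> b) / D *
      (1 / (q - 1) * (\<Sum>\<chi>\<in>mult_chars. C \<chi>))"
    unfolding sum_distrib_left sum.distrib[symmetric]
    by (rule sum.cong) (simp_all add: add_divide_distrib distrib_left mult_ac)
  finally show ?thesis
    unfolding sum_hyp[symmetric] hyp_m[symmetric] n1 n2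
    unfolding D_def a_def b_def c_def .
qed

end
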